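(* Let $n\ge N\ge1$ be integers. The following holds. (a) If $N$ is even and $n$ is a sum of $N/2$ prime numbers, then $\ell(n,N)\ne0$. (b) If $N$ is odd and $n$ is a sum of $(N+1)/2$ prime numbers, then $\ell(n,N)\ne0$.
   Context: For $2\le N\le n$, $\ell(n,N)$ is the number of compositions $(\lambda_1,\dots,\lambda_N)\in\mathbb Z_{>0}^N$ with $\lambda_1+\dots+\lambda_N=n$ such that $\lambda_i+\lambda_{i+1}$ is a prime number for all $i=1,\dots,N-1$. For $N=1$, $\ell(n,1)=1$ for all $n\ge1$. The primes in a sum of primes need not be distinct. *)

theory Defs
  imports "HOL-Computational_Algebra.Primes"
begin

(* The composition (lambda_1, ..., lambda_N) is the list xs with lambda_i = xs ! (i - 1). *)
definition prime_compositions :: "nat \<Rightarrow> nat \<Rightarrow> nat list set" where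
  "prime_compositions n N =
     {xs. length xs = N \<and> (\<forall>x\<in>set xs. 0 < x) \<and> sum_list xs = n \<and>
          (\<forall>i. Suc i < N \<longrightarrow> prime (xs ! i + xs ! Suc i))}"

definition ell :: "nat \<Rightarrow> nat \<Rightarrow> nat" where
  "ell n N = card (prime_compositions n N)"

(* A list, so that primes may be repeated. *)
definition sum_of_primes :: "nat \<Rightarrow> nat \<Rightarrow> bool" where
  "sum_of_primes k n \<longleftrightarrow>
     (\<exists>ps :: nat list. length ps = k \<and> (\<forall>p\<in>set ps. prime p) \<and> sum_list ps = n)"

(* card is 0 on infinite sets; this set is always finite, so ell is the actual count. *)
lemma finite_prime_compositions: "finite (prime_compositions n N)"
proof (rule finite_subset)
  show "prime_compositions n N \<subseteq> {xs. set xs \<subseteq> {..n} \<and> length xs = N}"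
    by (auto simp: prime_compositions_def intro: member_le_sum_list)
  show "finite {xs. set xs \<subseteq> {..n} \<and> length xs = N}"
    by (rule finite_lists_length_eq) simp
qed

(* The convention l(n,1) = 1 is the case N = 1 of the definition of ell. *)
lemma ell_1: "1 \<le> n \<Longrightarrow> ell n 1 = 1"
proof -
  assume "1 \<le> n"
  then have "prime_compositions n 1 = {[n]}"
    by (auto simp: prime_compositions_def length_Suc_conv)
  then show ?thesis by (simp add: ell_def)
qed

end

theory Submission
  imports Defs Complex_Main "HOL-Library.Discrete_Functions"
begin

text \<open>
  Given a seed \<open>a\<close> and numbers \<open>q\<^sub>1, \<dots>, q\<^sub>k\<close> greater than \<open>a\<close>, consider the zigzag
  \<open>a, q\<^sub>1 - a, a, q\<^sub>2 - a, \<dots>, a, q\<^sub>k - a\<close>, possibly followed by one more \<open>a\<close>. All entries are positive.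
  Since every other entry is \<open>a\<close>, each sum of two neighbours is one of the \<open>q\<^sub>i\<close>, so it is prime
  when all \<open>q\<^sub>i\<close> are. The total is \<open>q\<^sub>1 + \<dots> + q\<^sub>k\<close>, plus \<open>a\<close> if the final \<open>a\<close> is present.

  For even length the seed \<open>a = 1\<close> turns any representation of \<open>n\<close> as a sum of primes into a
  composition. For odd length one needs \<open>n = a + q\<^sub>1 + \<dots> + q\<^sub>k\<close> with \<open>a\<close> positive and strictly below
  all the primes \<open>q\<^sub>i\<close>, whereas the hypothesis gives \<open>k + 1\<close> primes with sum \<open>n\<close>. If the smallest of
  these primes occurs only once, it is the seed. If the smallest prime \<open>p\<close> occurs twice, Bertrand's
  postulate gives a prime \<open>s\<close> with \<open>p < s < 2 p\<close>, and \<open>p + p\<close> is replaced by \<open>a + s\<close> with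
  \<open>a = 2 p - s < p\<close> (lemma \<open>sum_of_primes_eq_less_add_primes\<close>). Bertrand's postulate is unavoidable
  here: a composition of \<open>2 p\<close> into three parts has adjacent sums \<open>r, s < 2 p\<close> with \<open>r + s > 2 p\<close>,
  so one of them lies strictly between \<open>p\<close> and \<open>2 p\<close>.

  Bertrand's postulate is proved by Erdos's argument: the central binomial coefficient
  \<open>2 n choose n\<close> is at least \<open>4 ^ n / (2 n)\<close>, but without primes in \<open>(n, 2 n]\<close> its prime factors would
  be too few and too small. The bounds used are \<open>primorial_le\<close> (the product of the primes up to \<open>k\<close>
  is at most \<open>4 ^ k\<close>), \<open>prime_power_dvd_binomial_le\<close> (a prime power dividing \<open>2 n choose n\<close> is at
  most \<open>2 n\<close>) and \<open>prime_not_dvd_central_binomial\<close> (no odd prime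
  factor lies in \<open>(2 n / 3, n]\<close>).
\<close>

section \<open>Primorials\<close>

lemma prod_primes_dvd:
  fixes m :: nat
  assumes "finite S" "\<And>p. p \<in> S \<Longrightarrow> prime p" "\<And>p. p \<in> S \<Longrightarrow> p dvd m"
  shows "\<Prod>S dvd m"
  using assms
proof (induction S rule: finite_induct)
  case (insert p S)
  have "coprime p (\<Prod>S)"
    using insert by (intro prod_coprime_right primes_coprime) auto
  with insert show ?case
    by (simp add: divides_mult)
qed simp

text \<open>
  The prime occurs in the numerator of \<open>n! / (k! (n - k)!)\<close> and cannot be cancelled, both factorials
  in the denominator being products of smaller numbers.
\<close>
lemma prime_dvd_binomial:
  fixes p :: nat
  assumes "prime p" "p \<le> n" "k < p" "n - k < p"
  shows "p dvd n choose k"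
proof -
  have "k \<le> n" using assms by linarith
  then have "fact k * fact (n - k) * (n choose k) = fact n"
    by (rule binomial_fact_lemma)
  moreover have "p dvd fact n"
    using assms by (simp add: prime_dvd_fact_iff)
  moreover have "\<not> p dvd fact k" "\<not> p dvd fact (n - k)"
    using assms by (simp_all add: prime_dvd_fact_iff)
  ultimately show ?thesis
    using assms(1) by (metis prime_dvd_mult_iff)
qed

text \<open>
  Of the \<open>2 ^ (2 m + 1)\<close> subsets of a set of size \<open>2 m + 1\<close>, exactly half have at most \<open>m\<close> elements.
\<close>
lemma binomial_odd_middle_le: "(2 * m + 1) choose m \<le> 4 ^ m"
proof -
  have "(2 * m + 1) choose m \<le> (\<Sum>k\<le>m. (2 * m + 1) choose k)"
    by (rule member_le_sum) auto
  also have "\<dots> = 4 ^ m"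
    by (simp only: binomial_r_part_sum power_mult) simp
  finally show ?thesis .
qed

text \<open>
  Strong induction; an even \<open>n > 2\<close> is not prime, so it adds nothing. For odd
  \<open>n = 2 m + 1\<close> the primes in \<open>(m + 1, 2 m + 1]\<close> all
  divide \<open>2 m + 1 choose m\<close>, so their product is at most \<open>4 ^ m\<close>, while the smaller primes
  contribute at most \<open>4 ^ (m + 1)\<close> by induction.
\<close>
lemma primorial_le: "\<Prod>{p::nat. prime p \<and> p \<le> n} \<le> 4 ^ n"
proof (induction n rule: less_induct)
  case (less n)
  have fin: "finite {p::nat. prime p \<and> p \<le> k}" for k
    by (rule finite_subset[of _ "{..k}"]) auto
  consider "n \<le> 2" | "n > 2" "even n" | "n > 2" "odd n" by linarith
  then show ?case
  proof cases
    case 1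
    have "{p::nat. prime p \<and> p \<le> n} \<subseteq> {2}"
      using 1 by (auto dest: prime_ge_2_nat)
    then have "{p::nat. prime p \<and> p \<le> n} = {} \<or> {p::nat. prime p \<and> p \<le> n} = {2}"
      by (simp add: subset_singleton_iff)
    then show ?thesis
    proof
      assume eq: "{p::nat. prime p \<and> p \<le> n} = {2}"
      then have "n \<ge> 2" by auto
      with 1 have "n = 2" by simp
      then show ?thesis by (subst eq) simp
    next
      assume eq: "{p::nat. prime p \<and> p \<le> n} = {}"
      show ?thesis by (subst eq) simp
    qed
  next
    case 2
    have "\<not> prime n" using 2 prime_odd_nat by blast
    then have "{p. prime p \<and> p \<le> n} = {p. prime p \<and> p \<le> n - 1}"
      using 2 by (auto simp: le_less)
    moreover have "(4::nat) ^ (n - 1) \<le> 4 ^ n"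
      by (rule power_increasing) auto
    moreover have "\<Prod>{p. prime p \<and> p \<le> n - 1} \<le> 4 ^ (n - 1)"
      using 2 by (intro less) auto
    ultimately show ?thesis by (metis order.trans)
  next
    case 3
    then obtain m where m: "n = 2 * m + 1" by (auto elim: oddE)
    define S where "S = {p. prime p \<and> m + 1 < p \<and> p \<le> n}"
    have "finite S"
      unfolding S_def by (rule finite_subset[OF _ fin[of n]]) auto
    have "\<Prod>S dvd n choose m"
      using \<open>finite S\<close> by (rule prod_primes_dvd) (auto simp: S_def m intro!: prime_dvd_binomial)
    then have "\<Prod>S \<le> n choose m"
      by (rule dvd_imp_le) (simp add: m)
    also have "\<dots> \<le> 4 ^ m"
      using binomial_odd_middle_le[of m] by (simp add: m)
    finally have S: "\<Prod>S \<le> 4 ^ m" .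
    have "{p. prime p \<and> p \<le> n} = {p. prime p \<and> p \<le> m + 1} \<union> S"
      using 3 by (auto simp: S_def m)
    moreover have "{p. prime p \<and> p \<le> m + 1} \<inter> S = {}"
      by (auto simp: S_def)
    ultimately have "\<Prod>{p. prime p \<and> p \<le> n} = \<Prod>{p. prime p \<and> p \<le> m + 1} * \<Prod>S"
      using \<open>finite S\<close> fin[of "m + 1"] by (simp add: prod.union_disjoint)
    also have "\<dots> \<le> 4 ^ (m + 1) * 4 ^ m"
      using less[of "m + 1"] 3 S by (intro mult_le_mono) (auto simp: m)
    also have "\<dots> = 4 ^ n"
      by (simp add: m power_add[symmetric] mult_2)
    finally show ?thesis .
  qed
qed

section \<open>Prime powers dividing binomial coefficients\<close>

text \<open>
  Put \<open>a(n, m) = 1 / (m (n choose m))\<close>. These are the entries of Leibniz's harmonic triangle: they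
  satisfy \<open>a(n, 1) = 1 / n\<close> and \<open>a(n, m + 1) = a(n - 1, m) - a(n, m)\<close>. Hence every \<open>a(n, m)\<close> is an
  integer combination of \<open>1, 1/2, \<dots>, 1/n\<close>, and multiplying it by \<open>Lcm {1..n}\<close> gives an integer. In
  the step below, \<open>A\<close>, \<open>B\<close> and \<open>X\<close> are the denominators of the three entries in the recurrence, which
  in cleared form reads \<open>X * (B - A) = A * B\<close>.
\<close>
lemma times_binomial_dvd_Lcm:
  assumes "m \<le> n"
  shows "Suc m * (Suc n choose Suc m) dvd Lcm {1..Suc n}"
  using assms
proof (induction m arbitrary: n)
  case 0
  show ?case by (simp add: dvd_Lcm)
next
  case (Suc m)
  then obtain k where n: "n = Suc k" and "m \<le> k"
    by (metis Suc_le_D Suc_le_mono)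
  define L where "L = Lcm {1..Suc n}"
  define A where "A = Suc m * (n choose Suc m)"
  define B where "B = Suc m * (Suc n choose Suc m)"
  define D where "D = Suc m * (n choose m)"
  define X where "X = Suc (Suc m) * (Suc n choose Suc (Suc m))"
  have "A dvd Lcm {1..n}"
    using Suc.IH[OF \<open>m \<le> k\<close>] by (simp only: A_def n)
  also have "Lcm {1..n} dvd L"
    unfolding L_def by (rule Lcm_subset) auto
  finally obtain a where a: "L = A * a" by (elim dvdE)
  have "B dvd L"
    unfolding B_def L_def using Suc.IH[of n] Suc.prems by simp
  then obtain b where b: "L = B * b" by (elim dvdE)
  have B: "B = A + D"
    by (simp add: A_def B_def D_def algebra_simps)
  have X_eq: "X = Suc n * (n choose Suc m)"
    unfolding X_def by (rule Suc_times_binomial)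
  have B_eq: "B = Suc n * (n choose m)"
    unfolding B_def by (rule Suc_times_binomial)
  have XD: "X * D = A * B"
    unfolding X_eq B_eq A_def D_def by (simp only: mult_ac)
  have "A > 0" "B > 0"
    using Suc.prems by (simp_all add: A_def B_def)
  have "int L * (int A * int B) = int X * (int a - int b) * (int A * int B)"
  proof -
    have 1: "int L = int A * int a" "int L = int B * int b" "int B = int A + int D"
        "int X * int D = int A * int B"
      using a b B XD by (metis of_nat_mult of_nat_add)+
    have "int X * (int a - int b) * (int A * int B)
        = int X * ((int A * int a) * int B - (int B * int b) * int A)"
      by (simp add: algebra_simps)
    also have "\<dots> = int X * (int L * int B - int L * int A)"
      using 1 by metis
    also have "\<dots> = int L * (int X * int D)"
      unfolding 1(3) by (simp add: algebra_simps)
    finally show ?thesis unfolding 1(4) by (rule sym)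
  qed
  then have "int L = int X * (int a - int b)"
    using \<open>A > 0\<close> \<open>B > 0\<close> by simp
  then have "int X dvd int L" by simp
  then show ?case by (simp only: X_def L_def int_dvd_int_iff)
qed

lemma prime_power_dvd_Lcm:
  fixes p :: nat
  assumes "finite S" "S \<noteq> {}" "prime p" "p ^ k dvd Lcm S" "0 \<notin> S"
  shows "\<exists>i\<in>S. p ^ k dvd i"
  using assms
proof (induction S rule: finite_ne_induct)
  case (singleton x)
  then show ?case by simp
next
  case (insert x S)
  have nz: "x \<noteq> 0" "Lcm S \<noteq> 0"
    using insert by (auto simp: Lcm_0_iff)
  have "k \<le> multiplicity p (lcm x (Lcm S))"
    using insert nz by (intro multiplicity_geI) auto
  also have "\<dots> = max (multiplicity p x) (multiplicity p (Lcm S))"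
    using nz insert.prems(1) by (intro multiplicity_lcm) auto
  finally have "p ^ k dvd x \<or> p ^ k dvd Lcm S"
    by (auto simp: le_max_iff_disj intro: multiplicity_dvd')
  then show ?case using insert by auto
qed

text \<open>
  The binomial coefficient divides \<open>Lcm {1..n}\<close>, and a prime power dividing a least common multiple
  already divides one of the numbers, here one that is at most \<open>n\<close>.
\<close>
lemma prime_power_dvd_binomial_le:
  fixes p :: nat
  assumes "prime p" "p ^ k dvd n choose m" "1 \<le> m" "m \<le> n"
  shows "p ^ k \<le> n"
proof -
  obtain m' n' where [simp]: "m = Suc m'" "n = Suc n'"
    using assms by (metis One_nat_def Suc_le_D le_trans)
  have "n choose m dvd m * (n choose m)" by simp
  also have "\<dots> dvd Lcm {1..n}"
    using times_binomial_dvd_Lcm[of m' n'] assms by simp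
  finally have "p ^ k dvd Lcm {1..n}"
    using assms(2) dvd_trans by blast
  then obtain i where "i \<in> {1..n}" "p ^ k dvd i"
    using prime_power_dvd_Lcm[of "{1..n}" p k] assms by auto
  then show ?thesis
    by (auto dest: dvd_imp_le)
qed

text \<open>
  The only multiple of \<open>p\<close> among \<open>n + 1, \<dots>, 2 n\<close> is \<open>2 p\<close>, so \<open>p\<close> divides \<open>(n + 1) \<cdots> (2 n)\<close> exactly
  once. That product is \<open>n!\<close> times the binomial coefficient, and \<open>n!\<close> uses up this single factor.
\<close>
lemma prime_not_dvd_central_binomial:
  fixes p :: nat
  assumes "prime p" "p > 2" "p \<le> n" "2 * n < 3 * p"
  shows "\<not> p dvd (2 * n) choose n"
proof
  assume dvd: "p dvd (2 * n) choose n"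
  define R where "R = \<Prod>({n+1..2*n} - {2*p})"
  have fact_eq: "fact (2 * n) = fact n * \<Prod>{n+1..2*n}"
  proof -
    have "{1..2 * n} = {1..n} \<union> {n+1..2*n}" by auto
    then show ?thesis by (simp add: fact_prod prod.union_disjoint)
  qed
  have "fact n * fact n * ((2 * n) choose n) = fact (2 * n)"
    using binomial_fact_lemma[of n "2 * n"] by simp
  then have "fact n * ((2 * n) choose n) = \<Prod>{n+1..2*n}"
    unfolding fact_eq by (simp add: mult.assoc)
  also have "\<dots> = 2 * p * R"
    unfolding R_def using assms by (subst prod.remove[of _ "2 * p"]) auto
  finally have eq: "fact n * ((2 * n) choose n) = 2 * p * R" .
  have "p * p dvd fact n * ((2 * n) choose n)"
    using assms dvd by (intro mult_dvd_mono) (auto simp: prime_dvd_fact_iff)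
  then have "p dvd 2 * R"
    using assms unfolding eq by (simp add: mult.assoc mult.left_commute)
  moreover have "\<not> p dvd 2"
    using assms by (auto dest: dvd_imp_le)
  ultimately have "p dvd R"
    using assms(1) by (simp add: prime_dvd_mult_iff)
  then have "\<exists>i\<in>{n+1..2*n} - {2*p}. p dvd i"
    using assms(1) unfolding R_def by (subst (asm) prime_dvd_prod_iff) auto
  then obtain i where i: "i \<in> {n+1..2*n}" "i \<noteq> 2 * p" "p dvd i"
    by blast
  then obtain c where "i = p * c" by (elim dvdE)
  moreover have "c < 3"
  proof (rule ccontr)
    assume "\<not> c < 3"
    then have "p * 3 \<le> p * c" by (intro mult_le_mono) auto
    with i(1) \<open>i = p * c\<close> assms(4) show False by auto
  qed
  then have "c = 0 \<or> c = 1 \<or> c = 2" by linarith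
  ultimately show False
    using i assms by auto
qed

section \<open>Bertrand's postulate\<close>

lemma four_power_le_central_binomial:
  assumes "n > 0"
  shows "4 ^ n \<le> 2 * n * ((2 * n) choose n)"
proof -
  have "real (4 ^ n) \<le> real (2 * n * ((2 * n) choose n))"
    using central_binomial_lower_bound[OF assms] assms by (simp add: field_simps)
  then show ?thesis by (simp only: of_nat_le_iff)
qed

text \<open>
  Prime factors of the coefficient are at most \<open>2 n\<close>, hence at most \<open>n\<close> by hypothesis, hence at most
  \<open>2 n / 3\<close> by the preceding section. There are at most \<open>s - 1\<close> of them
  up to \<open>s\<close> (\<open>1\<close> is not prime), each contributing a prime power of at most \<open>2 n\<close>. The ones above \<open>s\<close>
  have squares exceeding \<open>2 n\<close>, so they occur only once and the primorial bound controls their product.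
\<close>
lemma central_binomial_le_if_no_prime:
  assumes no_prime: "\<And>p. prime p \<Longrightarrow> n < p \<Longrightarrow> p \<le> 2 * n \<Longrightarrow> False"
    and "n \<ge> 3" and s: "1 \<le> s" "2 * n < (s + 1) ^ 2"
  shows "(2 * n) choose n \<le> (2 * n) ^ (s - 1) * 4 ^ (2 * n div 3)"
proof -
  define C where "C = (2 * n) choose n"
  have "C > 0" by (simp add: C_def)
  have pow_le: "p ^ multiplicity p C \<le> 2 * n" if "prime p" for p
    using prime_power_dvd_binomial_le[OF that, of "multiplicity p C" "2 * n" n] \<open>n \<ge> 3\<close>
    by (simp add: C_def multiplicity_dvd)
  have le: "p \<le> 2 * n div 3" if "p \<in> prime_factors C" for p
  proof -
    have p: "prime p" "p dvd C" using that by auto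
    have "multiplicity p C \<ge> 1"
      using p \<open>C > 0\<close> by (intro multiplicity_geI) auto
    then have "p ^ 1 \<le> p ^ multiplicity p C"
      using p by (intro power_increasing) (auto dest: prime_gt_0_nat)
    then have "p \<le> 2 * n" using pow_le[OF p(1)] by simp
    then have "p \<le> n" using no_prime[of p] p by force
    moreover have "p > 2 \<Longrightarrow> \<not> 2 * n < 3 * p"
      using prime_not_dvd_central_binomial[of p n] p \<open>p \<le> n\<close> by (auto simp: C_def)
    ultimately show ?thesis using \<open>n \<ge> 3\<close> by (cases "p > 2") linarith+
  qed
  define P where "P = {p \<in> prime_factors C. p \<le> s}"
  define Q where "Q = {p \<in> prime_factors C. s < p}"
  have P: "(\<Prod>p\<in>P. p ^ multiplicity p C) \<le> (2 * n) ^ (s - 1)"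
  proof -
    have "(\<Prod>p\<in>P. p ^ multiplicity p C) \<le> (\<Prod>p\<in>P. 2 * n)"
      by (intro prod_mono) (auto simp: P_def intro: pow_le)
    also have "\<dots> = (2 * n) ^ card P" by simp
    also have "\<dots> \<le> (2 * n) ^ (s - 1)"
    proof (rule power_increasing)
      have "P \<subseteq> {2..s}" by (auto simp: P_def intro!: prime_ge_2_nat)
      then have "card P \<le> card {2..s}" by (intro card_mono) auto
      then show "card P \<le> s - 1" by simp
    qed (use \<open>n \<ge> 3\<close> in simp)
    finally show ?thesis .
  qed
  have Q: "(\<Prod>p\<in>Q. p ^ multiplicity p C) \<le> 4 ^ (2 * n div 3)"
  proof -
    have "(\<Prod>p\<in>Q. p ^ multiplicity p C) \<le> \<Prod>Q"
    proof (rule prod_mono, safe)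
      fix p assume "p \<in> Q"
      then have p: "prime p" "s + 1 \<le> p" by (auto simp: Q_def)
      have "multiplicity p C \<le> 1"
      proof (rule ccontr)
        assume "\<not> multiplicity p C \<le> 1"
        then have "p ^ 2 \<le> p ^ multiplicity p C"
          using p by (intro power_increasing) (auto dest: prime_gt_0_nat)
        moreover have "(s + 1) ^ 2 \<le> p ^ 2"
          using p(2) by (rule power_mono) simp
        ultimately show False using s(2) pow_le[OF p(1)] by linarith
      qed
      then have "p ^ multiplicity p C \<le> p ^ 1"
        using p by (intro power_increasing) (auto dest: prime_gt_0_nat)
      then show "p ^ multiplicity p C \<le> p" by simp
    qed
    also have "\<Prod>Q \<le> \<Prod>{p. prime p \<and> p \<le> 2 * n div 3}"
    proof (intro dvd_imp_le prod_dvd_prod_subset)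
      show "finite {p. prime p \<and> p \<le> 2 * n div 3}"
        by (rule finite_subset[of _ "{..2 * n div 3}"]) auto
      show "Q \<subseteq> {p. prime p \<and> p \<le> 2 * n div 3}"
        using le by (auto simp: Q_def)
    qed (auto intro!: prod_pos prime_gt_0_nat)
    also have "\<dots> \<le> 4 ^ (2 * n div 3)" by (rule primorial_le)
    finally show ?thesis .
  qed
  have "C = (\<Prod>p\<in>prime_factors C. p ^ multiplicity p C)"
    using \<open>C > 0\<close> by (rule prime_factorization_nat)
  also have "prime_factors C = P \<union> Q" by (auto simp: P_def Q_def)
  also have "(\<Prod>p\<in>P \<union> Q. p ^ multiplicity p C)
      = (\<Prod>p\<in>P. p ^ multiplicity p C) * (\<Prod>p\<in>Q. p ^ multiplicity p C)"
    by (rule prod.union_disjoint) (auto simp: P_def Q_def)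
  also have "\<dots> \<le> (2 * n) ^ (s - 1) * 4 ^ (2 * n div 3)"
    using P Q by (rule mult_le_mono)
  finally show ?thesis by (simp add: C_def)
qed

text \<open>
  The inequality fails at \<open>s = 29\<close>. This is what determines the threshold in the next lemma.
\<close>
lemma power6_less_two_power:
  fixes s :: nat
  assumes "30 \<le> s"
  shows "(s + 1) ^ 6 < 2 ^ s"
  using assms
proof (induction s rule: dec_induct)
  case base
  show ?case by simp
next
  case (step s)
  \<comment> \<open>It suffices that the left side grows by a factor of at most \<open>(32 / 31) ^ 6 < 2\<close>.\<close>
  have "31 * (s + 2) \<le> 32 * (s + 1)" using step by simp
  then have "(31 * (s + 2)) ^ 6 \<le> (32 * (s + 1)) ^ 6"
    by (rule power_mono) simp
  then have "31 ^ 6 * (s + 2) ^ 6 \<le> 32 ^ 6 * (s + 1) ^ 6"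
    by (simp only: power_mult_distrib)
  then have "(s + 2) ^ 6 \<le> 2 * (s + 1) ^ 6" by simp
  with step show ?case by simp
qed

text \<open>
  With \<open>s\<close> the integer part of the square root of \<open>2 n\<close>, the two bounds on the central binomial
  coefficient give \<open>4 ^ n \<le> (2 n) ^ s * 4 ^ (2 n / 3)\<close>. Cubing turns this into
  \<open>4 ^ n \<le> (2 n) ^ (3 s)\<close>, and \<open>s\<^sup>2 \<le> 2 n < (s + 1)\<^sup>2\<close> reduces it to \<open>2 ^ s \<le> (s + 1) ^ 6\<close>. This is
  false once \<open>s \<ge> 30\<close>, that is, once \<open>2 n \<ge> 900\<close>.
\<close>
lemma bertrand_large:
  fixes n :: nat
  assumes "450 \<le> n"
  shows "\<exists>p. prime p \<and> n < p \<and> p \<le> 2 * n"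
proof (rule ccontr)
  assume no_prime: "\<not> ?thesis"
  define s where "s = floor_sqrt (2 * n)"
  have s: "s ^ 2 \<le> 2 * n" "2 * n < (s + 1) ^ 2"
    using Suc_floor_sqrt_power2_gt[of "2 * n"] by (auto simp: s_def)
  have "s \<ge> 30"
  proof (rule ccontr)
    assume "\<not> s \<ge> 30"
    then have "(s + 1) ^ 2 \<le> 30 ^ 2" by (intro power_mono) auto
    with s(2) assms show False by simp
  qed
  define f where "f = 2 * n div 3"
  have f: "3 * f \<le> 2 * n" by (simp add: f_def)
  have "4 ^ n \<le> 2 * n * ((2 * n) choose n)"
    using assms by (intro four_power_le_central_binomial) simp
  also have "\<dots> \<le> 2 * n * ((2 * n) ^ (s - 1) * 4 ^ f)"
    unfolding f_def using no_prime assms s(2) \<open>s \<ge> 30\<close>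
    by (intro mult_le_mono central_binomial_le_if_no_prime) auto
  also have "\<dots> = (2 * n) ^ s * 4 ^ f"
    using \<open>s \<ge> 30\<close> by (cases s) simp_all
  finally have "(4 ^ n) ^ 3 \<le> ((2 * n) ^ s * 4 ^ f) ^ 3"
    by (rule power_mono) simp
  also have "\<dots> = (2 * n) ^ (3 * s) * 4 ^ (3 * f)"
    by (simp only: power_mult_distrib power_mult[symmetric] mult.commute)
  also have "\<dots> \<le> (2 * n) ^ (3 * s) * 4 ^ (2 * n)"
    by (intro mult_le_mono order.refl power_increasing f) simp
  finally have "4 ^ n * 4 ^ (2 * n) \<le> (2 * n) ^ (3 * s) * 4 ^ (2 * n)"
    by (simp add: power_mult[symmetric] power_add[symmetric] mult.commute)
  then have "4 ^ n \<le> (2 * n) ^ (3 * s)" by simp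
  also have "\<dots> \<le> ((s + 1) ^ 2) ^ (3 * s)"
    using s(2) by (intro power_mono) auto
  also have "\<dots> = ((s + 1) ^ 6) ^ s"
    by (simp add: power_mult[symmetric])
  also have "\<dots> < (2 ^ s) ^ s"
    using power6_less_two_power[OF \<open>s \<ge> 30\<close>] \<open>s \<ge> 30\<close> by (intro power_strict_mono) auto
  also have "\<dots> = 2 ^ (s ^ 2)"
    by (simp add: power_mult[symmetric] power2_eq_square)
  also have "\<dots> \<le> 2 ^ (2 * n)"
    using s(1) by (rule power_increasing) simp
  also have "\<dots> = 4 ^ n" by (simp add: power_mult)
  finally show False by simp
qed

lemma primeI_trial_division:
  fixes n :: nat
  assumes "1 < n" "n < k ^ 2" "\<forall>d\<in>set [2..<k]. \<not> d dvd n"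
  shows "prime n"
proof (rule ccontr)
  assume "\<not> prime n"
  then obtain a b where ab: "n = a * b" "a \<noteq> 1" "b \<noteq> 1"
    using assms(1) by (auto simp: prime_nat_iff dvd_def)
  then have "a \<ge> 2" "b \<ge> 2"
    using assms(1) by (cases a; cases b; auto)+
  moreover have "k \<le> d" if "d dvd n" "d \<ge> 2" for d
    using assms(3) that by force
  ultimately have "k \<le> a" "k \<le> b"
    using ab(1) by auto
  then have "k * k \<le> n" unfolding ab(1) by (rule mult_le_mono)
  with assms(2) show False by (simp add: power2_eq_square)
qed

text \<open>
  Below \<open>450\<close> a chain of primes suffices in which each is less than twice its predecessor:
  \<open>2, 3, 5, 7, 13, 23, 43, 83, 163, 317, 631\<close>. If no prime lay in \<open>(n, 2 n]\<close>, then \<open>n\<close> could be pushed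
  down this chain: a prime above \<open>n\<close> is above \<open>2 n\<close>, so \<open>n\<close> is below its predecessor too.
\<close>
theorem bertrand:
  fixes n :: nat
  assumes "2 \<le> n"
  shows "\<exists>p. prime p \<and> n < p \<and> p < 2 * n"
proof -
  have "\<exists>p. prime p \<and> n < p \<and> p \<le> 2 * n"
  proof (rule ccontr)
    assume no_prime: "\<not> ?thesis"
    have step: "2 * n < q" if "prime q" "n < q" for q
      using no_prime that by (meson not_less)
    \<comment> \<open>Divisors below 26 suffice, as \<open>631 < 26\<^sup>2\<close>.\<close>
    have large: "prime (83::nat)" "prime (163::nat)" "prime (317::nat)" "prime (631::nat)"
      by (rule primeI_trial_division[where k = 26]; simp)+
    have "\<not> 450 \<le> n" using bertrand_large[of n] no_prime by blast
    then have "n < 631" by simp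
    then have "n < 317" using step[OF large(4)] by simp
    then have "n < 163" using step[OF large(3)] by simp
    then have "n < 83" using step[OF large(2)] by simp
    then have "n < 43" using step[OF large(1)] by simp
    then have "n < 23" using step[of 43] by simp
    then have "n < 13" using step[of 23] by simp
    then have "n < 7" using step[of 13] by simp
    then have "n < 5" using step[of 7] by simp
    then have "n < 3" using step[of 5] by simp
    then have "n < 2" using step[of 3] by simp
    then show False using assms by simp
  qed
  then obtain p where p: "prime p" "n < p" "p \<le> 2 * n" by blast
  have "p \<noteq> 2 * n"
  proof
    assume "p = 2 * n"
    then have "even p" "2 < p" using assms by simp_all
    then show False using prime_odd_nat[OF p(1)] by blast
  qed
  with p(3) have "p < 2 * n" by simp
  with p(1,2) show ?thesis by blast
qed

section \<open>Zigzag compositions\<close>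

definition zigzag :: "nat \<Rightarrow> nat list \<Rightarrow> nat list" where
  "zigzag a qs = concat (map (\<lambda>q. [a, q - a]) qs)"

lemma zigzag_simps [simp]:
  "zigzag a [] = []"
  "zigzag a (q # qs) = a # (q - a) # zigzag a qs"
  by (simp_all add: zigzag_def)

lemma length_zigzag: "length (zigzag a qs) = 2 * length qs"
  by (induction qs) auto

lemma sum_list_zigzag: "\<forall>q\<in>set qs. a \<le> q \<Longrightarrow> sum_list (zigzag a qs) = sum_list qs"
  by (induction qs) auto

lemma zigzag_pos: "0 < a \<Longrightarrow> \<forall>q\<in>set qs. a < q \<Longrightarrow> \<forall>x\<in>set (zigzag a qs). 0 < x"
  by (induction qs) auto

text \<open>
  The lists with and without the final \<open>a\<close> are both used. The longer one gives an induction that goes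
  through, since it always begins with \<open>a\<close>; the statement for the shorter one follows.
\<close>
lemma successively_zigzag:
  assumes "\<forall>q\<in>set qs. a \<le> q \<and> prime q"
  shows "successively (\<lambda>x y. prime (x + y)) (zigzag a qs @ [a])"
  using assms
proof (induction qs)
  case (Cons q qs)
  then show ?case
    by (cases qs) (auto simp: successively_Cons)
qed simp

lemma ell_nonzeroI:
  assumes "length xs = N" "\<forall>x\<in>set xs. 0 < x" "sum_list xs = n"
    "successively (\<lambda>x y. prime (x + y)) xs"
  shows "ell n N \<noteq> 0"
proof -
  have "xs \<in> prime_compositions n N"
    using assms by (auto simp: prime_compositions_def successively_conv_nth)
  then show ?thesis
    using finite_prime_compositions[of n N] by (auto simp: ell_def)
qed

lemma ell_even_nonzero:
  assumes "\<forall>q\<in>set qs. prime q"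
  shows "ell (sum_list qs) (2 * length qs) \<noteq> 0"
proof (rule ell_nonzeroI)
  have gt1: "\<forall>q\<in>set qs. 1 < q"
    using assms prime_gt_1_nat by blast
  show "length (zigzag 1 qs) = 2 * length qs" by (rule length_zigzag)
  show "\<forall>x\<in>set (zigzag 1 qs). 0 < x" using gt1 by (intro zigzag_pos) auto
  show "sum_list (zigzag 1 qs) = sum_list qs" using gt1 by (intro sum_list_zigzag) auto
  show "successively (\<lambda>x y. prime (x + y)) (zigzag 1 qs)"
    using successively_zigzag[of qs 1] assms gt1
    by (simp add: successively_append_iff less_imp_le)
qed

lemma ell_odd_nonzero:
  assumes "0 < a" "\<forall>q\<in>set qs. a < q \<and> prime q"
  shows "ell (a + sum_list qs) (2 * length qs + 1) \<noteq> 0"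
proof (rule ell_nonzeroI)
  show "length (zigzag a qs @ [a]) = 2 * length qs + 1" by (simp add: length_zigzag)
  show "\<forall>x\<in>set (zigzag a qs @ [a]). 0 < x" using zigzag_pos[of a qs] assms by auto
  show "sum_list (zigzag a qs @ [a]) = a + sum_list qs"
    using sum_list_zigzag[of qs a] assms by (simp add: less_imp_le)
  show "successively (\<lambda>x y. prime (x + y)) (zigzag a qs @ [a])"
    using assms by (intro successively_zigzag) auto
qed

lemma remove_member_of_list:
  fixes x :: "'a :: comm_monoid_add"
  assumes "x \<in> set xs"
  obtains ys where "set ys \<subseteq> set xs" "Suc (length ys) = length xs"
    "x + sum_list ys = sum_list xs"
proof -
  obtain us vs where "xs = us @ x # vs"
    using split_list[OF assms] by blast
  then show thesis
    by (intro that[of "us @ vs"]) (auto simp: add.left_commute)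
qed

text \<open>
  This supplies the seed of an odd zigzag. The smallest prime \<open>p\<close> serves if it occurs once. Otherwise
  two copies of it are traded for a larger prime \<open>s < 2 p\<close> and the seed \<open>2 p - s\<close>, which is smaller
  than \<open>p\<close> and hence than all the primes.
\<close>
lemma sum_of_primes_eq_less_add_primes:
  fixes ps :: "nat list"
  assumes "ps \<noteq> []" "\<forall>p\<in>set ps. prime p"
  obtains a qs where "0 < a" "\<forall>q\<in>set qs. a < q \<and> prime q"
    "Suc (length qs) = length ps" "a + sum_list qs = sum_list ps"
proof -
  define p where "p = Min (set ps)"
  have p: "p \<in> set ps" "\<forall>q\<in>set ps. p \<le> q"
    using assms(1) by (auto simp: p_def)
  obtain qs where qs: "set qs \<subseteq> set ps" "Suc (length qs) = length ps"
      "p + sum_list qs = sum_list ps"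
    using p(1) by (rule remove_member_of_list)
  show thesis
  proof (cases "p \<in> set qs")
    case False
    have "\<forall>q\<in>set qs. p < q \<and> prime q"
      using False p(2) qs(1) assms(2) by (metis le_neq_implies_less subsetD)
    moreover have "0 < p" using p(1) assms(2) prime_gt_0_nat by blast
    ultimately show thesis
      using qs(2,3) by (intro that[of p qs])
  next
    case True
    have "2 \<le> p" using p(1) assms(2) prime_ge_2_nat by blast
    then obtain s where s: "prime s" "p < s" "s < 2 * p"
      using bertrand by blast
    obtain rs where rs: "set rs \<subseteq> set qs" "Suc (length rs) = length qs"
        "p + sum_list rs = sum_list qs"
      using True by (rule remove_member_of_list)
    show thesis
    proof (rule that[of "2 * p - s" "s # rs"])
      show "0 < 2 * p - s" using s by simp
      show "\<forall>q\<in>set (s # rs). 2 * p - s < q \<and> prime q"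
      proof
        fix q assume "q \<in> set (s # rs)"
        then have "q = s \<or> q \<in> set ps" using rs(1) qs(1) by auto
        then have "p \<le> q" "prime q" using s p(2) assms(2) by auto
        moreover have "2 * p - s < p" using s(2,3) by linarith
        ultimately show "2 * p - s < q \<and> prime q" by simp
      qed
      show "Suc (length (s # rs)) = length ps" using rs qs by simp
      show "2 * p - s + sum_list (s # rs) = sum_list ps" using rs qs s by simp
    qed
  qed
qed

theorem theorem6p12:
  fixes n N :: nat
  assumes "1 \<le> N" and "N \<le> n"
  shows "(even N \<and> sum_of_primes (N div 2) n \<longrightarrow> ell n N \<noteq> 0) \<and>
         (odd N \<and> sum_of_primes ((N + 1) div 2) n \<longrightarrow> ell n N \<noteq> 0)"
proof (intro conjI impI; elim conjE)
  assume "even N" "sum_of_primes (N div 2) n"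
  then obtain ps where ps: "length ps = N div 2" "\<forall>p\<in>set ps. prime p" "sum_list ps = n"
    by (auto simp: sum_of_primes_def)
  have "2 * length ps = N"
    using ps(1) \<open>even N\<close> by simp
  then show "ell n N \<noteq> 0"
    using ell_even_nonzero[OF ps(2)] ps(3) by metis
next
  assume "odd N" "sum_of_primes ((N + 1) div 2) n"
  then obtain ps where ps: "length ps = (N + 1) div 2" "\<forall>p\<in>set ps. prime p" "sum_list ps = n"
    by (auto simp: sum_of_primes_def)
  have "ps \<noteq> []" using ps(1) \<open>1 \<le> N\<close> by auto
  then obtain a qs where qs: "0 < a" "\<forall>q\<in>set qs. a < q \<and> prime q"
      "Suc (length qs) = length ps" "a + sum_list qs = sum_list ps"
    using ps(2) by (rule sum_of_primes_eq_less_add_primes)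
  have "2 * length qs + 1 = N"
    using qs(3) ps(1) \<open>odd N\<close> by presburger
  then show "ell n N \<noteq> 0"
    using ell_odd_nonzero[OF qs(1,2)] qs(4) ps(3) by metis
qed

end
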